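(* Let $\chi=(\hbar,\vartheta,B_{\mathrm{in}})$ be a nondegenerate real central character, $L=(a_x,a_y)$ spatial periods with $a_x,a_y>0$, and $A=a_xa_y$. Let $\Theta_{\chi,L}$ be the deformation matrix of the Weyl unitaries $U_j=e^{i\hat v_j}$ for the intrinsic normalization $$\hat v_1=\frac{\hat X}{a_x},\quad \hat v_2=\frac{\hat Y}{a_y},\quad \hat v_3=\frac{a_x\hat\Pi_x}{\hbar},\quad \hat v_4=\frac{a_y\hat\Pi_y}{\hbar}.$$ Then $$\operatorname{Pf}(\Theta_{\chi,L})=\frac{\vartheta B_{\mathrm{in}}-\hbar}{(2\pi)^2\hbar}.$$ In particular, the coefficient $\operatorname{Pf}(\Theta_{\chi,L})$ of the degree-four component $Q$ in the gap-label formula for $\mathfrak G_{\chi,L}(p)=\tau_*([p])$ is independent of $A=a_xa_y$.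
   Context: $\chi=(\hbar,\vartheta,B_{\mathrm{in}})\in\mathbb R^3$ is nondegenerate if $\hbar\neq0$ and $\hbar-B_{\mathrm{in}}\vartheta\neq0$. The operators $\hat X,\hat Y,\hat\Pi_x,\hat\Pi_y$ are self-adjoint operators (in a regular irreducible representation, i.e. one integrating to a unitary group representation) with $[\hat X,\hat Y]=i\vartheta\hat I$, $[\hat\Pi_x,\hat\Pi_y]=i\hbar B_{\mathrm{in}}\hat I$, $[\hat X,\hat\Pi_x]=[\hat Y,\hat\Pi_y]=i\hbar\hat I$ and all other commutators zero. By the Baker--Campbell--Hausdorff formula, $U_iU_j=e^{2\pi i(\Theta_{\chi,L})_{ij}}U_jU_i$, where $\Theta_{\chi,L}$ is the real skew-symmetric $4\times4$ matrix given by $2\pi i(\Theta_{\chi,L})_{ij}\hat I=-[\hat v_i,\hat v_j]$, that is, $$\Theta_{12}=-\frac{\vartheta}{2\pi a_xa_y},\quad \Theta_{13}=\Theta_{24}=-\frac1{2\pi},\quad \Theta_{34}=-\frac{B_{\mathrm{in}}a_xa_y}{2\pi\hbar},\quad \Theta_{14}=\Theta_{23}=0.$$ $\operatorname{Pf}(\Theta)=\Theta_{12}\Theta_{34}-\Theta_{13}\Theta_{24}+\Theta_{14}\Theta_{23}$ for a skew $4\times 4$ matrix. Gap-label formula: $A^4_\Theta$ is the smooth noncommutative $4$-torus generated by unitaries with $U_iU_j=e^{2\pi i\Theta_{ij}}U_jU_i$, with canonical normalized trace $\tau$ and induced map $\tau_*:K_0(A^4_\Theta)\to\mathbb R$. One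 has $K_0(A^4_\Theta)\cong\Lambda^{\mathrm{even}}\mathbb Z^4\cong\mathbb Z^8$, and the class of a projection $p\in M_n(A^4_\Theta)$ is written $[p]=(N;C_{12},C_{13},C_{14},C_{23},C_{24},C_{34};Q)$ with $N$, $C_{ij}$, $Q$ the degree-zero, degree-two and degree-four components; then $$\mathfrak G_{\chi,L}(p)=\tau_*([p])=N+\sum_{i<j}(\Theta_{\chi,L})_{ij}C_{ij}+\operatorname{Pf}(\Theta_{\chi,L})\,Q .$$ *)

theory Defs
  imports "HOL-Analysis.Analysis" "HOL-Algebra.Group"
begin

section \<open>Complex Hilbert spaces and unbounded operators\<close>

text \<open>The form \<open>cinner\<close> is conjugate-linear in its first argument.\<close>

class complex_hilbert = real_inner + complete_space +
  fixes scaleC :: "complex \<Rightarrow> 'a \<Rightarrow> 'a" (infixr "*\<^sub>C" 75)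
    and cinner :: "'a \<Rightarrow> 'a \<Rightarrow> complex"
  assumes scaleC_add_right: "a *\<^sub>C (x + y) = a *\<^sub>C x + a *\<^sub>C y"
    and scaleC_add_left: "(a + b) *\<^sub>C x = a *\<^sub>C x + b *\<^sub>C x"
    and scaleC_scaleC: "a *\<^sub>C b *\<^sub>C x = (a * b) *\<^sub>C x"
    and scaleC_of_real: "complex_of_real r *\<^sub>C x = scaleR r x"
    and cinner_commute: "cinner x y = cnj (cinner y x)"
    and cinner_add_right: "cinner x (y + z) = cinner x y + cinner x z"
    and cinner_scaleC_right: "cinner x (a *\<^sub>C y) = a * cinner x y"
    and Re_cinner: "Re (cinner x y) = inner x y"

text \<open>A densely defined unbounded operator is represented by its graph.\<close>

type_synonym 'h op = "('h \<times> 'h) set"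

definition op_scale :: "real \<Rightarrow> 'h::real_vector op \<Rightarrow> 'h op" where
  "op_scale r A = {(x, r *\<^sub>R y) |x y. (x, y) \<in> A}"

text \<open>\<open>AB - BA\<close>, on the natural domain of vectors to which both products apply.
  Note that \<open>AB\<close> is the relation composition \<open>B O A\<close>.\<close>

definition commutator :: "'h::ab_group_add op \<Rightarrow> 'h op \<Rightarrow> 'h op" where
  "commutator A B = {(x, y - z) |x y z. (x, y) \<in> B O A \<and> (x, z) \<in> A O B}"

definition adjoint_op :: "'h::complex_hilbert op \<Rightarrow> 'h op" where
  "adjoint_op A = {(y, z). \<forall>(x, w) \<in> A. cinner w y = cinner x z}"

definition self_adjoint :: "'h::complex_hilbert op \<Rightarrow> bool" where
  "self_adjoint A \<longleftrightarrow> closure (Domain A) = UNIV \<and> adjoint_op A = A"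

text \<open>The largest common domain that all operators of the family map to itself.\<close>

definition smooth_domain :: "('i \<Rightarrow> 'h op) \<Rightarrow> 'h set" where
  "smooth_domain A = \<Union>{D. \<forall>j. \<forall>x\<in>D. \<exists>y\<in>D. (x, y) \<in> A j}"

definition commutator_scalar_on ::
  "'h::complex_hilbert set \<Rightarrow> 'h op \<Rightarrow> 'h op \<Rightarrow> complex \<Rightarrow> bool" where
  "commutator_scalar_on D A B c \<longleftrightarrow>
     (\<forall>x\<in>D. x \<in> Domain (commutator A B) \<and> (\<forall>y. (x, y) \<in> commutator A B \<longrightarrow> y = c *\<^sub>C x))"

section \<open>Unitary groups and regular irreducible representations\<close>

definition unitary_op :: "('h::complex_hilbert \<Rightarrow> 'h) \<Rightarrow> bool" where
  "unitary_op U \<longleftrightarrow>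
     (\<forall>x y. U (x + y) = U x + U y) \<and> (\<forall>a x. U (a *\<^sub>C x) = a *\<^sub>C U x) \<and>
     surj U \<and> (\<forall>x y. cinner (U x) (U y) = cinner x y)"

definition unitary_group :: "(real \<Rightarrow> 'h::complex_hilbert \<Rightarrow> 'h) \<Rightarrow> bool" where
  "unitary_group V \<longleftrightarrow>
     (\<forall>t. unitary_op (V t)) \<and> (\<forall>s t x. V (s + t) x = V s (V t x)) \<and>
     (\<forall>x. continuous_on UNIV (\<lambda>t. V t x))"

text \<open>Stone generator: \<open>V t = exp (i t A)\<close> for \<open>A = generator V\<close>.\<close>

definition generator :: "(real \<Rightarrow> 'h::complex_hilbert \<Rightarrow> 'h) \<Rightarrow> 'h op" where
  "generator V = {(x, y). ((\<lambda>h. (- \<i>) *\<^sub>C ((V h x - x) /\<^sub>R h)) \<longlongrightarrow> y) (at 0)}"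

text \<open>\<open>exp (i A)\<close> for self-adjoint \<open>A\<close>, unique by Stone's theorem.\<close>

definition exp_i :: "'h::complex_hilbert op \<Rightarrow> 'h \<Rightarrow> 'h" where
  "exp_i A = (THE U. \<exists>V. unitary_group V \<and> generator V = A \<and> U = V 1)"

text \<open>Elements of the index type \<open>4\<close> are written \<open>1, 2, 3, 4\<close>, where \<open>4 = 0\<close>.\<close>

definition quad :: "'a \<Rightarrow> 'a \<Rightarrow> 'a \<Rightarrow> 'a \<Rightarrow> 4 \<Rightarrow> 'a" where
  "quad a b c d j = (if j = 1 then a else if j = 2 then b else if j = 3 then c else d)"

definition nondegenerate :: "real \<Rightarrow> real \<Rightarrow> real \<Rightarrow> bool" where
  "nondegenerate hbar \<theta> B \<longleftrightarrow> hbar \<noteq> 0 \<and> hbar - B * \<theta> \<noteq> 0"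

text \<open>The commutation relations are \<open>[A j, A k] = i (comm_form j k)\<close> for the family
  \<open>A = quad X Y Px Py\<close>.\<close>

definition comm_form :: "real \<Rightarrow> real \<Rightarrow> real \<Rightarrow> 4 \<Rightarrow> 4 \<Rightarrow> real" where
  "comm_form hbar \<theta> B = quad
     (quad 0 \<theta> hbar 0)
     (quad (- \<theta>) 0 0 hbar)
     (quad (- hbar) 0 0 (hbar * B))
     (quad 0 (- hbar) (- hbar * B) 0)"

text \<open>The integrated form of the relations: \<open>W s = exp (i (\<Sum>j. s$j A j))\<close>, which by
  Baker-Campbell-Hausdorff has the multiplier \<open>exp (- (i/2) \<omega>(s, t))\<close>. Equivalently, this is a
  strongly continuous unitary representation of the nilpotent group whose centre acts by
  the character \<open>(hbar, \<theta>, B)\<close>.\<close>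

definition weyl_system ::
  "real \<Rightarrow> real \<Rightarrow> real \<Rightarrow> (real^4 \<Rightarrow> 'h::complex_hilbert \<Rightarrow> 'h) \<Rightarrow> bool" where
  "weyl_system hbar \<theta> B W \<longleftrightarrow>
     (\<forall>s. unitary_op (W s)) \<and>
     (\<forall>s t x. W s (W t x) =
        exp (- (\<i> / 2) * of_real (\<Sum>j\<in>UNIV. \<Sum>k\<in>UNIV. s$j * comm_form hbar \<theta> B j k * t$k))
          *\<^sub>C W (s + t) x) \<and>
     (\<forall>x. continuous_on UNIV (\<lambda>s. W s x))"

definition irreducible_system :: "('s \<Rightarrow> 'h::complex_hilbert \<Rightarrow> 'h) \<Rightarrow> bool" where
  "irreducible_system W \<longleftrightarrow>
     (\<exists>x::'h. x \<noteq> 0) \<and>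
     (\<forall>S. closed S \<and> 0 \<in> S \<and> (\<forall>x\<in>S. \<forall>y\<in>S. x + y \<in> S) \<and> (\<forall>a. \<forall>x\<in>S. a *\<^sub>C x \<in> S) \<and>
          (\<forall>s. \<forall>x\<in>S. W s x \<in> S) \<longrightarrow> S = {0} \<or> S = UNIV)"

definition regular_irrep ::
  "real \<Rightarrow> real \<Rightarrow> real \<Rightarrow> 'h::complex_hilbert op \<Rightarrow> 'h op \<Rightarrow> 'h op \<Rightarrow> 'h op \<Rightarrow> bool" where
  "regular_irrep hbar \<theta> B X Y Px Py \<longleftrightarrow>
     (let A = quad X Y Px Py in
       (\<forall>j. self_adjoint (A j)) \<and>
       closure (smooth_domain A) = UNIV \<and>
       (\<forall>j k. commutator_scalar_on (smooth_domain A) (A j) (A k)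
                (\<i> * of_real (comm_form hbar \<theta> B j k))) \<and>
       (\<exists>W. weyl_system hbar \<theta> B W \<and> irreducible_system W \<and>
            (\<forall>j. A j = generator (\<lambda>t. W (t *\<^sub>R axis j 1)))))"

section \<open>Weyl unitaries and their deformation matrix\<close>

definition intrinsic_v ::
  "real \<Rightarrow> real \<Rightarrow> real \<Rightarrow> 'h::real_vector op \<Rightarrow> 'h op \<Rightarrow> 'h op \<Rightarrow> 'h op \<Rightarrow> 4 \<Rightarrow> 'h op" where
  "intrinsic_v hbar ax ay X Y Px Py = quad
     (op_scale (1 / ax) X) (op_scale (1 / ay) Y)
     (op_scale (ax / hbar) Px) (op_scale (ay / hbar) Py)"

text \<open>The relations among the \<open>U j = exp (i v j)\<close> alone fix the entries only modulo integers;
  the commutators \<open>[v i, v j] = - 2 \<pi> i \<Theta> i j\<close> select the representative.\<close>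

definition deformation_matrix :: "(4 \<Rightarrow> 'h::complex_hilbert op) \<Rightarrow> real^4^4" where
  "deformation_matrix v = (THE \<Theta>.
     (\<forall>i j. \<Theta>$j$i = - \<Theta>$i$j) \<and>
     (\<forall>i j. commutator_scalar_on (smooth_domain v) (v i) (v j)
              (- (2 * of_real pi * \<i> * of_real (\<Theta>$i$j)))) \<and>
     (\<forall>i j x. exp_i (v i) (exp_i (v j) x) =
        exp (2 * of_real pi * \<i> * of_real (\<Theta>$i$j)) *\<^sub>C exp_i (v j) (exp_i (v i) x)))"

definition Pf :: "real^4^4 \<Rightarrow> real" where
  "Pf \<Theta> = \<Theta>$1$2 * \<Theta>$3$4 - \<Theta>$1$3 * \<Theta>$2$4 + \<Theta>$1$4 * \<Theta>$2$3"

section \<open>The smooth noncommutative 4-torus\<close>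

text \<open>An element \<open>a\<close> stands for the series \<open>\<Sum>m. a m u(m)\<close> over \<open>m \<in> \<int>\<^sup>4\<close> with rapidly decreasing
  coefficients, where \<open>u(m) u(n) = exp (\<pi> i m\<cdot>\<Theta>n) u(m + n)\<close> and \<open>u(m)* = u(- m)\<close>. For skew
  \<open>\<Theta>\<close>, the unitaries \<open>u(e i)\<close> satisfy \<open>u(e i) u(e j) = exp (2 \<pi> i \<Theta> i j) u(e j) u(e i)\<close>.\<close>

type_synonym nct = "int^4 \<Rightarrow> complex"

definition smooth_elem :: "nct \<Rightarrow> bool" where
  "smooth_elem a \<longleftrightarrow>
     (\<forall>k::nat. bounded (range (\<lambda>m. of_int ((1 + (\<Sum>j\<in>UNIV. \<bar>m$j\<bar>)) ^ k) * a m)))"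

definition nct_mult :: "real^4^4 \<Rightarrow> nct \<Rightarrow> nct \<Rightarrow> nct" where
  "nct_mult \<Theta> a b m = (\<Sum>\<^sub>\<infinity>n. a n * b (m - n) *
     exp (of_real pi * \<i> *
       of_real (\<Sum>i\<in>UNIV. \<Sum>j\<in>UNIV. of_int (n$i) * \<Theta>$i$j * of_int ((m - n)$j))))"

definition nct_star :: "nct \<Rightarrow> nct" where
  "nct_star a m = cnj (a (- m))"

definition nct_trace :: "nct \<Rightarrow> complex" where
  "nct_trace a = a 0"

text \<open>Matrices are padded by zero outside their format.\<close>

type_synonym nct_mat = "nat \<Rightarrow> nat \<Rightarrow> nct"

definition nct_mats :: "nat \<Rightarrow> nat \<Rightarrow> nct_mat set" where
  "nct_mats r c = {M. \<forall>i j. smooth_elem (M i j) \<and> (i \<ge> r \<or> j \<ge> c \<longrightarrow> M i j = (\<lambda>_. 0))}"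

text \<open>The first argument after the matrix \<open>\<Theta>\<close> is the inner dimension of the product.\<close>

definition mat_times :: "real^4^4 \<Rightarrow> nat \<Rightarrow> nct_mat \<Rightarrow> nct_mat \<Rightarrow> nct_mat" where
  "mat_times \<Theta> l M N i j m = (\<Sum>k<l. nct_mult \<Theta> (M i k) (N k j) m)"

definition mat_star :: "nct_mat \<Rightarrow> nct_mat" where
  "mat_star M i j = nct_star (M j i)"

definition projections :: "real^4^4 \<Rightarrow> (nat \<times> nct_mat) set" where
  "projections \<Theta> = {(n, p). p \<in> nct_mats n n \<and> mat_times \<Theta> n p p = p \<and> mat_star p = p}"

definition mvn_equiv :: "real^4^4 \<Rightarrow> nat \<times> nct_mat \<Rightarrow> nat \<times> nct_mat \<Rightarrow> bool" where
  "mvn_equiv \<Theta> P Q \<longleftrightarrow> (\<exists>v \<in> nct_mats (fst Q) (fst P).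
     mat_times \<Theta> (fst Q) (mat_star v) v = snd P \<and>
     mat_times \<Theta> (fst P) v (mat_star v) = snd Q)"

fun proj_sum :: "nat \<times> nct_mat \<Rightarrow> nat \<times> nct_mat \<Rightarrow> nat \<times> nct_mat" (infixl "\<boxplus>" 65) where
  "(n, p) \<boxplus> (m, q) = (n + m, \<lambda>i j.
     if i < n \<and> j < n then p i j
     else if i \<ge> n \<and> j \<ge> n then q (i - n) (j - n)
     else (\<lambda>_. 0))"

definition zero_proj :: "nat \<times> nct_mat" where
  "zero_proj = (0, \<lambda>_ _ _. 0)"

section \<open>K-theory, trace and gap labels\<close>

text \<open>The Grothendieck group of projections: \<open>(P, Q)\<close> stands for the formal
  difference \<open>[P] - [Q]\<close>.\<close>

type_synonym proj_diff = "(nat \<times> nct_mat) \<times> (nat \<times> nct_mat)"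

definition K0_rel :: "real^4^4 \<Rightarrow> (proj_diff \<times> proj_diff) set" where
  "K0_rel \<Theta> = {((P, Q), (P', Q')).
     {P, Q, P', Q'} \<subseteq> projections \<Theta> \<and>
     (\<exists>R \<in> projections \<Theta>. mvn_equiv \<Theta> (P \<boxplus> Q' \<boxplus> R) (P' \<boxplus> Q \<boxplus> R))}"

definition K0 :: "real^4^4 \<Rightarrow> proj_diff set monoid" where
  "K0 \<Theta> = \<lparr>
     carrier = (projections \<Theta> \<times> projections \<Theta>) // K0_rel \<Theta>,
     mult = (\<lambda>x y. \<Union>(P, Q)\<in>x. \<Union>(P', Q')\<in>y. K0_rel \<Theta> `` {(P \<boxplus> P', Q \<boxplus> Q')}),
     one = K0_rel \<Theta> `` {(zero_proj, zero_proj)}\<rparr>"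

definition K0_class :: "real^4^4 \<Rightarrow> nat \<times> nct_mat \<Rightarrow> proj_diff set" where
  "K0_class \<Theta> P = K0_rel \<Theta> `` {(P, zero_proj)}"

text \<open>The trace of a projection is real, so taking real parts loses nothing.\<close>

fun proj_trace :: "nat \<times> nct_mat \<Rightarrow> real" where
  "proj_trace (n, p) = Re (\<Sum>i<n. nct_trace (p i i))"

definition K0_trace :: "real^4^4 \<Rightarrow> proj_diff set \<Rightarrow> real" where
  "K0_trace \<Theta> x = (THE r. \<forall>(P, Q)\<in>x. r = proj_trace P - proj_trace Q)"

definition gap_label :: "real^4^4 \<Rightarrow> nat \<times> nct_mat \<Rightarrow> real" where
  "gap_label \<Theta> P = K0_trace \<Theta> (K0_class \<Theta> P)"

text \<open>\<open>\<Lambda>\<^sup>e\<^sup>v\<^sup>e\<^sup>n \<int>\<^sup>4\<close>, with elements written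
  \<open>(N, (C12, C13, C14, C23, C24, C34), Q)\<close>.\<close>

type_synonym lambda_even = "int \<times> (int \<times> int \<times> int \<times> int \<times> int \<times> int) \<times> int"

definition lambda_even_group :: "lambda_even monoid" where
  "lambda_even_group = \<lparr>carrier = UNIV, mult = (+), one = 0\<rparr>"

text \<open>The right-hand side of the gap-label formula with coefficient \<open>c\<close> in degree four.\<close>

fun gap_label_form :: "real^4^4 \<Rightarrow> real \<Rightarrow> lambda_even \<Rightarrow> real" where
  "gap_label_form \<Theta> c (N, (C12, C13, C14, C23, C24, C34), Q) =
     of_int N +
     (\<Theta>$1$2 * of_int C12 + \<Theta>$1$3 * of_int C13 + \<Theta>$1$4 * of_int C14 +
      \<Theta>$2$3 * of_int C23 + \<Theta>$2$4 * of_int C24 + \<Theta>$3$4 * of_int C34) +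
     c * of_int Q"

text \<open>Identifications \<open>K\<^sub>0 \<cong> \<Lambda>\<^sup>e\<^sup>v\<^sup>e\<^sup>n \<int>\<^sup>4\<close> for which the gap-label formula holds. Elliott's
  isomorphism is one; the formula need not determine it.\<close>

definition K0_coordinates :: "real^4^4 \<Rightarrow> (proj_diff set \<Rightarrow> lambda_even) \<Rightarrow> bool" where
  "K0_coordinates \<Theta> \<kappa> \<longleftrightarrow>
     \<kappa> \<in> iso (K0 \<Theta>) lambda_even_group \<and>
     (\<forall>P \<in> projections \<Theta>. gap_label \<Theta> P = gap_label_form \<Theta> (Pf \<Theta>) (\<kappa> (K0_class \<Theta> P)))"

end

theory Submission
  imports Defs
begin

text \<open>Stone's uniqueness theorem identifies each \<open>exp (i v j)\<close> with the Weyl operator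
  \<open>W (c j e j)\<close>, where \<open>v j = c j A j\<close>, so the Weyl relations give the exchange relations with
  \<open>\<Theta> i j = - c i c j \<omega> i j / 2\<pi>\<close>. The commutators on the dense smooth domain, which rescaling
  does not change, determine \<open>\<Theta>\<close>. In the Pfaffian each product \<open>\<Theta> i j \<Theta> k l\<close> contains every
  \<open>c j\<close> once, and \<open>c 1 c 2 c 3 c 4 = 1 / hbar\<^sup>2\<close> does not depend on the periods.\<close>

section \<open>Complex Hilbert spaces\<close>

lemma scaleC_zero_left [simp]: "0 *\<^sub>C (x :: 'h::complex_hilbert) = 0"
  using scaleC_of_real[of 0 x] by simp

lemma scaleC_one [simp]: "1 *\<^sub>C (x :: 'h::complex_hilbert) = x"
  using scaleC_of_real[of 1 x] by simp

lemma scaleC_scaleR: "a *\<^sub>C (r *\<^sub>R x) = r *\<^sub>R (a *\<^sub>C (x :: 'h::complex_hilbert))"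
  by (simp flip: scaleC_of_real add: scaleC_scaleC mult.commute)

lemma scaleC_zero_right [simp]: "a *\<^sub>C 0 = (0 :: 'h::complex_hilbert)"
  using scaleC_scaleR[of a 0 0] by simp

lemma scaleR_scaleC:
  "r *\<^sub>R (a *\<^sub>C x) = (complex_of_real r * a) *\<^sub>C (x :: 'h::complex_hilbert)"
  by (simp flip: scaleC_of_real add: scaleC_scaleC)

lemma scaleC_right_cancel:
  fixes x :: "'h::complex_hilbert"
  assumes "x \<noteq> 0" "a *\<^sub>C x = b *\<^sub>C x"
  shows "a = b"
proof (rule ccontr)
  assume "a \<noteq> b"
  have "(a - b) *\<^sub>C x + b *\<^sub>C x = b *\<^sub>C x"
    using assms(2) by (simp flip: scaleC_add_left)
  then have "(a - b) *\<^sub>C x = 0"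
    by simp
  then have "inverse (a - b) *\<^sub>C (a - b) *\<^sub>C x = inverse (a - b) *\<^sub>C 0 *\<^sub>C x"
    by simp
  with \<open>a \<noteq> b\<close> assms(1) show False
    by (simp add: scaleC_scaleC)
qed

lemma cinner_scaleR_right:
  "cinner x (r *\<^sub>R y) = of_real r * cinner x (y :: 'h::complex_hilbert)"
  by (simp flip: scaleC_of_real add: cinner_scaleC_right)

lemma cinner_scaleC_left:
  "cinner (a *\<^sub>C x) y = cnj a * cinner x (y :: 'h::complex_hilbert)"
  by (metis cinner_commute cinner_scaleC_right complex_cnj_mult)

lemma cinner_self: "cinner x x = of_real (inner x (x :: 'h::complex_hilbert))"
  by (metis Re_cinner cinner_commute Reals_cnj_iff of_real_Re)

text \<open>The norm comes from the real inner product, so its complex homogeneity is derived from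
  sesquilinearity of \<open>cinner\<close>: the two scalars combine to
  \<open>a * cnj a\<close>.\<close>

lemma norm_scaleC: "norm (a *\<^sub>C x) = cmod a * norm (x :: 'h::complex_hilbert)"
proof (rule power2_eq_imp_eq)
  have "inner (a *\<^sub>C x) (a *\<^sub>C x) = Re (a * cnj a * cinner x x)"
    by (simp flip: Re_cinner add: cinner_scaleC_left cinner_scaleC_right mult_ac)
  also have "\<dots> = (cmod a)\<^sup>2 * inner x x"
    by (simp add: cinner_self complex_norm_square[symmetric] del: of_real_power flip: of_real_mult of_real_power)
  finally show "(norm (a *\<^sub>C x))\<^sup>2 = (cmod a * norm x)\<^sup>2"
    by (simp add: power2_norm_eq_inner power_mult_distrib)
qed auto

lemma bounded_linear_scaleC: "bounded_linear (\<lambda>x :: 'h::complex_hilbert. a *\<^sub>C x)"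
  by (rule bounded_linear_intro[where K = "cmod a"])
     (simp_all add: scaleC_add_right scaleC_scaleR norm_scaleC mult.commute)

section \<open>Unitary groups and Stone uniqueness\<close>

lemma unitary_op_norm: "unitary_op U \<Longrightarrow> norm (U x) = norm x"
  unfolding unitary_op_def norm_eq_sqrt_inner by (metis Re_cinner)

lemma unitary_op_bounded_linear: "unitary_op U \<Longrightarrow> bounded_linear U"
  by (rule bounded_linear_intro[where K = 1])
     (simp_all add: unitary_op_norm, simp_all add: unitary_op_def flip: scaleC_of_real)

text \<open>The group law makes \<open>V 0\<close> idempotent, and an idempotent linear isometry is
  the identity.\<close>

lemma unitary_group_0:
  assumes "unitary_group V"
  shows "V 0 x = x"
proof -
  have U: "unitary_op (V 0)" and "V (0 + 0) x = V 0 (V 0 x)"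
    using assms unfolding unitary_group_def by blast+
  then have "V 0 (V 0 x - x) = 0"
    using linear_diff[OF bounded_linear.linear[OF unitary_op_bounded_linear[OF U]]] by simp
  then have "norm (V 0 x - x) = 0"
    using unitary_op_norm[OF U, of "V 0 x - x"] by simp
  then show ?thesis by simp
qed

text \<open>The Schroedinger equation on the domain of the generator: the difference quotient at
  \<open>t\<close> is \<open>V t\<close> applied to the one at 0, and \<open>V t\<close> is
  continuous.\<close>

lemma unitary_group_vector_derivative:
  assumes V: "unitary_group V" and g: "(x, y) \<in> generator V"
  shows "((\<lambda>t. V t x) has_vector_derivative \<i> *\<^sub>C V t y) (at t)"
proof -
  have U: "unitary_op (V t)" and add: "\<And>h. V (t + h) x = V t (V h x)"
    using V by (auto simp: unitary_group_def)
  note bl = unitary_op_bounded_linear[OF U]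
  have "((\<lambda>h. \<i> *\<^sub>C (- \<i>) *\<^sub>C ((V h x - x) /\<^sub>R h)) \<longlongrightarrow> \<i> *\<^sub>C y) (at 0)"
    using g by (intro bounded_linear.tendsto[OF bounded_linear_scaleC]) (simp add: generator_def)
  then have "((\<lambda>h. (V h x - x) /\<^sub>R h) \<longlongrightarrow> \<i> *\<^sub>C y) (at 0)"
    by (simp add: scaleC_scaleC)
  from bounded_linear.tendsto[OF bl this]
  have "((\<lambda>h. (V (t + h) x - V t x) /\<^sub>R h) \<longlongrightarrow> V t (\<i> *\<^sub>C y)) (at 0)"
    by (simp add: add linear_cmul[OF bounded_linear.linear[OF bl]]
        linear_diff[OF bounded_linear.linear[OF bl]])
  moreover have "V t (\<i> *\<^sub>C y) = \<i> *\<^sub>C V t y"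
    using U by (simp add: unitary_op_def)
  ultimately have "((\<lambda>h. (V (t + h) x - V t x) /\<^sub>R h) \<longlongrightarrow> \<i> *\<^sub>C V t y) (at 0)"
    by simp
  then have "((\<lambda>h. norm ((V (t + h) x - V t x) /\<^sub>R h - \<i> *\<^sub>C V t y)) \<longlongrightarrow> 0) (at 0)"
    by (simp add: tendsto_norm_zero_iff LIM_zero_iff)
  \<comment> \<open>This passes to the remainder form of the derivative. At \<open>h = 0\<close>
    division by zero gives 0 on the right but \<open>norm (V t y)\<close> on the left, so the
    equality is claimed only on the punctured neighbourhood.\<close>
  moreover have "\<forall>\<^sub>F h in at 0. norm ((V (t + h) x - V t x) /\<^sub>R h - \<i> *\<^sub>C V t y) =
      norm (V (t + h) x - V t x - h *\<^sub>R (\<i> *\<^sub>C V t y)) / norm h"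
  proof (rule eventually_at_topological[THEN iffD2], intro exI[of _ UNIV] conjI ballI impI)
    fix h :: real assume "h \<noteq> 0"
    then have "(V (t + h) x - V t x) /\<^sub>R h - \<i> *\<^sub>C V t y =
        (V (t + h) x - V t x - h *\<^sub>R (\<i> *\<^sub>C V t y)) /\<^sub>R h"
      by (simp add: algebra_simps)
    then show "norm ((V (t + h) x - V t x) /\<^sub>R h - \<i> *\<^sub>C V t y) =
      norm (V (t + h) x - V t x - h *\<^sub>R (\<i> *\<^sub>C V t y)) / norm h"
      by (simp add: divide_inverse mult.commute)
  qed auto
  ultimately have "((\<lambda>h. norm (V (t + h) x - V t x - h *\<^sub>R (\<i> *\<^sub>C V t y)) / norm h) \<longlongrightarrow> 0) (at 0)"
    by (rule Lim_transform_eventually)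
  then show ?thesis
    by (simp add: has_vector_derivative_def has_derivative_at bounded_linear_scaleR_left)
qed

text \<open>\<open>V t\<close> commutes with every \<open>V h\<close>, so it carries the difference
  quotients at \<open>x\<close> to those at \<open>V t x\<close>; continuity carries the limit
  along.\<close>

lemma generator_invariant:
  assumes V: "unitary_group V" and g: "(x, y) \<in> generator V"
  shows "(V t x, V t y) \<in> generator V"
proof -
  have U: "unitary_op (V t)" and add: "\<And>h. V t (V h x) = V h (V t x)"
    using V by (auto simp: unitary_group_def) (metis add.commute)
  note bl = unitary_op_bounded_linear[OF U]
  have "((\<lambda>h. V t ((- \<i>) *\<^sub>C ((V h x - x) /\<^sub>R h))) \<longlongrightarrow> V t y) (at 0)"
    using g by (intro bounded_linear.tendsto[OF bl]) (simp add: generator_def)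
  moreover have "V t (a *\<^sub>C z) = a *\<^sub>C V t z" for a z
    using U by (simp add: unitary_op_def)
  ultimately show ?thesis
    by (simp add: generator_def add linear_cmul[OF bounded_linear.linear[OF bl]]
        linear_diff[OF bounded_linear.linear[OF bl]])
qed

text \<open>The uniqueness half of Stone's theorem. For \<open>x\<close> in the domain, the inner
  product of \<open>V s x\<close> and \<open>V' s x\<close> is constant in \<open>s\<close>; as both
  orbits keep the norm of \<open>x\<close>, they coincide. Density of the domain extends this to all
  vectors.\<close>

lemma unitary_group_eqI:
  fixes V V' :: "real \<Rightarrow> 'h::complex_hilbert \<Rightarrow> 'h"
  assumes V: "unitary_group V" and V': "unitary_group V'"
    and gen: "generator V = A" "generator V' = A" and sa: "self_adjoint A"
  shows "V = V'"
proof (intro ext)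
  fix t and x :: 'h
  have on_domain: "V t x = V' t x" if "x \<in> Domain A" for x
  proof -
    from that obtain y where xy: "(x, y) \<in> A" by auto
    have sym: "cinner w u = cinner v z" if "(v, w) \<in> A" "(u, z) \<in> A" for u v w z
    proof -
      from that(2) sa have "(u, z) \<in> adjoint_op A" by (simp add: self_adjoint_def)
      with that(1) show ?thesis by (auto simp: adjoint_op_def)
    qed
    have "((\<lambda>s. inner (V s x) (V' s x)) has_vector_derivative 0) (at s)" for s
    proof -
      \<comment> \<open>Both groups preserve the graph of \<open>A\<close>, so symmetry applies to
        the pairs \<open>(V s x, V s y)\<close> and \<open>(V' s x, V' s y)\<close>.\<close>
      have "cinner (V s y) (V' s x) = cinner (V s x) (V' s y)"
        using generator_invariant[OF V, of x y s] generator_invariant[OF V', of x y s] xy gen sym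
        by auto
      \<comment> \<open>Conjugate-linearity on the left turns the two factors \<open>\<i>\<close>
        into opposite signs, so the product rule yields derivative 0.\<close>
      then have "inner (V s x) (\<i> *\<^sub>C V' s y) + inner (\<i> *\<^sub>C V s y) (V' s x) = 0"
        by (simp flip: Re_cinner add: cinner_scaleC_left cinner_scaleC_right)
      moreover have "((\<lambda>s. inner (V s x) (V' s x)) has_vector_derivative
          (inner (V s x) (\<i> *\<^sub>C V' s y) + inner (\<i> *\<^sub>C V s y) (V' s x))) (at s)"
        using xy gen V V'
        by (intro bounded_bilinear.has_vector_derivative[OF bounded_bilinear_inner]
            unitary_group_vector_derivative) auto
      ultimately show ?thesis by simp
    qed
    then have "inner (V t x) (V' t x) = inner (V 0 x) (V' 0 x)"
      by (intro DERIV_isconst_all allI)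
         (simp add: has_real_derivative_iff_has_vector_derivative)
    then have "inner (V t x) (V' t x) = inner x x"
      by (simp add: unitary_group_0[OF V] unitary_group_0[OF V'])
    moreover have "inner (V t x) (V t x) = inner x x" "inner (V' t x) (V' t x) = inner x x"
      using V V' by (simp_all add: unitary_group_def unitary_op_norm flip: power2_norm_eq_inner)
    \<comment> \<open>The expanded square has two diagonal terms and twice the mixed term, all equal
      to \<open>inner x x\<close>.\<close>
    ultimately have "inner (V t x - V' t x) (V t x - V' t x) = 0"
      by (simp add: inner_diff inner_commute)
    then show ?thesis by simp
  qed
  have "bounded_linear (V t)" "bounded_linear (V' t)"
    using V V' by (auto simp: unitary_group_def intro: unitary_op_bounded_linear)
  then have "closed {x. V t x = V' t x}"
    by (intro closed_Collect_eq linear_continuous_on)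
  moreover have "Domain A \<subseteq> {x. V t x = V' t x}"
    using on_domain by auto
  ultimately have "closure (Domain A) \<subseteq> {x. V t x = V' t x}"
    by (rule closure_minimal[rotated])
  then show "V t x = V' t x"
    using sa by (auto simp: self_adjoint_def)
qed

text \<open>Resolves the definite description in \<open>exp_i\<close>: \<open>V\<close> is a
  witness, and Stone uniqueness excludes any other.\<close>

lemma exp_i_generator:
  assumes "unitary_group V" "self_adjoint (generator V)"
  shows "exp_i (generator V) = V 1"
  unfolding exp_i_def using assms unitary_group_eqI by (intro the_equality) blast+

section \<open>Rescaling of operators\<close>

text \<open>Operators are bare relations here, so linearity is not built in. Closure under real
  multiples is the part of it that lets a scalar move through a product.\<close>

definition homogeneous_op :: "'h::real_vector op \<Rightarrow> bool" where
  "homogeneous_op A \<longleftrightarrow> (\<forall>r x y. (x, y) \<in> A \<longrightarrow> (r *\<^sub>R x, r *\<^sub>R y) \<in> A)"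

text \<open>The adjoint of any relation is homogeneous, and \<open>A\<close> equals its
  adjoint.\<close>

lemma self_adjoint_homogeneous: "self_adjoint A \<Longrightarrow> homogeneous_op A"
proof -
  have "homogeneous_op (adjoint_op A)"
    by (auto simp: homogeneous_op_def adjoint_op_def cinner_scaleR_right split_beta)
  then show "self_adjoint A \<Longrightarrow> homogeneous_op A"
    by (simp add: self_adjoint_def)
qed

lemma homogeneous_op_scale: "homogeneous_op A \<Longrightarrow> homogeneous_op (op_scale r A)"
  unfolding homogeneous_op_def op_scale_def using scaleR_left_commute[of _ r] by blast

lemma op_scale_op_scale: "op_scale r (op_scale s A) = op_scale (r * s) A"
  by (force simp: op_scale_def)

lemma op_scale_one [simp]: "op_scale 1 A = A"
  by (force simp: op_scale_def)

lemma mem_op_scale: "r \<noteq> 0 \<Longrightarrow> (x, y) \<in> op_scale r A \<longleftrightarrow> (x, y /\<^sub>R r) \<in> A"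
  by (force simp: op_scale_def)

text \<open>A nonzero real factor passes unchanged through the adjoint and leaves the domain
  alone.\<close>

lemma self_adjoint_op_scale:
  assumes sa: "self_adjoint A" and r: "r \<noteq> 0"
  shows "self_adjoint (op_scale r A)"
proof -
  have "(y, z) \<in> adjoint_op (op_scale r A) \<longleftrightarrow> (y, z /\<^sub>R r) \<in> adjoint_op A" for y z
  proof -
    have "cinner (r *\<^sub>R w) y = cinner x z \<longleftrightarrow> cinner w y = cinner x (z /\<^sub>R r)" for w x
    proof -
      have "cinner (r *\<^sub>R w) y = of_real r * cinner w y"
        by (simp flip: scaleC_of_real add: cinner_scaleC_left)
      moreover have "cinner x (z /\<^sub>R r) = cinner x z / of_real r"
        by (simp only: cinner_scaleR_right) (simp add: divide_inverse)
      ultimately show ?thesis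
        using r by (simp only:) (auto simp: field_simps)
    qed
    then show ?thesis
      by (force simp: adjoint_op_def op_scale_def)
  qed
  moreover have "Domain (op_scale r A) = Domain A"
    by (force simp: op_scale_def)
  ultimately show ?thesis
    using sa r by (auto simp: self_adjoint_def mem_op_scale)
qed

text \<open>\<open>B O A\<close> applies \<open>B\<close> first, so the factor \<open>s\<close> sits
  between the two operators; homogeneity of \<open>A\<close> moves it to the outside.\<close>

lemma op_scale_relcomp:
  assumes "homogeneous_op A" "s \<noteq> 0"
  shows "op_scale s B O op_scale r A = op_scale (r * s) (B O A)"
proof -
  have hom: "(k *\<^sub>R y, k *\<^sub>R w) \<in> A" if "(y, w) \<in> A" for k y w
    using assms(1) that by (simp add: homogeneous_op_def)
  \<comment> \<open>One direction multiplies the pair by \<open>inverse s\<close>, the other by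
    \<open>s\<close>.\<close>
  have A: "(s *\<^sub>R y, w) \<in> A \<longleftrightarrow> (y, w /\<^sub>R s) \<in> A" for y w
    using hom[of "s *\<^sub>R y" w "inverse s"] hom[of y "w /\<^sub>R s" s] assms(2) by auto
  have "(x, z) \<in> op_scale s B O op_scale r A \<longleftrightarrow>
      (x, z) \<in> op_scale (r * s) (B O A)" for x z
  proof -
    have "(x, z) \<in> op_scale s B O op_scale r A \<longleftrightarrow>
        (\<exists>y w. (x, y) \<in> B \<and> (s *\<^sub>R y, w) \<in> A \<and> z = r *\<^sub>R w)"
      by (auto simp: op_scale_def)
    also have "\<dots> \<longleftrightarrow> (\<exists>y w. (x, y) \<in> B \<and> (y, w) \<in> A \<and> z = (r * s) *\<^sub>R w)"
    proof -
      have "(\<exists>w. (s *\<^sub>R y, w) \<in> A \<and> z = r *\<^sub>R w) \<longleftrightarrow> (\<exists>w. (y, w) \<in> A \<and> z = (r * s) *\<^sub>R w)" for y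
      proof
        assume "\<exists>w. (s *\<^sub>R y, w) \<in> A \<and> z = r *\<^sub>R w"
        then obtain w where "(y, w /\<^sub>R s) \<in> A" "z = r *\<^sub>R w" using A by auto
        then show "\<exists>w. (y, w) \<in> A \<and> z = (r * s) *\<^sub>R w"
          using assms(2) by (intro exI[of _ "w /\<^sub>R s"]) simp
      next
        assume "\<exists>w. (y, w) \<in> A \<and> z = (r * s) *\<^sub>R w"
        then obtain w where "(y, w) \<in> A" "z = (r * s) *\<^sub>R w" by auto
        then show "\<exists>w. (s *\<^sub>R y, w) \<in> A \<and> z = r *\<^sub>R w"
          using A assms(2) by (intro exI[of _ "s *\<^sub>R w"]) simp
      qed
      then show ?thesis by blast
    qed
    also have "\<dots> \<longleftrightarrow> (x, z) \<in> op_scale (r * s) (B O A)"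
      by (auto simp: op_scale_def)
    finally show ?thesis .
  qed
  then show ?thesis
    by (simp only: set_eq_iff split_paired_All simp_thms)
qed

lemma commutator_op_scale:
  fixes A B :: "'a::real_vector op"
  assumes "homogeneous_op A" "homogeneous_op B" "r \<noteq> 0" "s \<noteq> 0"
  shows "commutator (op_scale r A) (op_scale s B) = op_scale (r * s) (commutator A B)"
proof -
  have "op_scale r A O op_scale s B = op_scale (r * s) (A O B)"
    using op_scale_relcomp[OF assms(2,3), of A s] by (simp add: mult.commute)
  moreover have "{(x, y - z) |x y z. (x, y) \<in> op_scale k P \<and> (x, z) \<in> op_scale k Q} =
      op_scale k {(x, y - z) |x y z. (x, y) \<in> P \<and> (x, z) \<in> Q}" for k and P Q :: "'a op"
    by (auto simp: op_scale_def) (metis scaleR_diff_right)+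
  ultimately show ?thesis
    unfolding commutator_def op_scale_relcomp[OF assms(1,4)] by simp
qed

lemma commutator_scalar_on_op_scale:
  assumes "homogeneous_op A" "homogeneous_op B" "r \<noteq> 0" "s \<noteq> 0"
    and "commutator_scalar_on D A B c"
  shows "commutator_scalar_on D (op_scale r A) (op_scale s B) (of_real (r * s) * c)"
  using assms(5) unfolding commutator_scalar_on_def commutator_op_scale[OF assms(1-4)]
  by (fastforce simp: op_scale_def scaleR_scaleC)

text \<open>It suffices to enlarge each invariant set of the family to one that the rescaled family
  also preserves.\<close>

lemma smooth_domain_subset_op_scale:
  assumes "\<And>j. homogeneous_op (A j)"
  shows "smooth_domain A \<subseteq> smooth_domain (\<lambda>j. op_scale (c j) (A j))"
proof
  fix x assume "x \<in> smooth_domain A"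
  then obtain D where D: "\<forall>j. \<forall>x\<in>D. \<exists>y\<in>D. (x, y) \<in> A j" and x: "x \<in> D"
    by (auto simp: smooth_domain_def)
  \<comment> \<open>\<open>D\<close> need not contain the multiples by \<open>c j\<close> of its
    elements, so all real multiples are adjoined.\<close>
  define D' where "D' = {r *\<^sub>R x |r x. x \<in> D}"
  have "\<exists>y\<in>D'. (z, y) \<in> op_scale (c j) (A j)" if "z \<in> D'" for j z
  proof -
    from that obtain r u where z: "z = r *\<^sub>R u" and "u \<in> D" by (auto simp: D'_def)
    with D obtain y where y: "y \<in> D" "(u, y) \<in> A j" by blast
    then have "(z, r *\<^sub>R y) \<in> A j"
      using assms z by (auto simp: homogeneous_op_def)
    then have "(z, c j *\<^sub>R r *\<^sub>R y) \<in> op_scale (c j) (A j)"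
      unfolding op_scale_def by blast
    moreover have "c j *\<^sub>R r *\<^sub>R y \<in> D'"
      unfolding D'_def using y(1) by (metis (mono_tags, lifting) mem_Collect_eq scaleR_scaleR)
    ultimately show ?thesis by blast
  qed
  moreover have "x \<in> D'"
    using x by (auto simp: D'_def intro!: exI[of _ 1] exI[of _ x])
  ultimately show "x \<in> smooth_domain (\<lambda>j. op_scale (c j) (A j))"
    unfolding smooth_domain_def by blast
qed

text \<open>The reverse inclusion is the previous lemma applied to the rescaled family with the
  factors \<open>inverse (c j)\<close>.\<close>

lemma smooth_domain_op_scale:
  assumes "\<And>j. homogeneous_op (A j)" "\<And>j. c j \<noteq> 0"
  shows "smooth_domain (\<lambda>j. op_scale (c j) (A j)) = smooth_domain A"
proof (rule antisym)
  have "smooth_domain (\<lambda>j. op_scale (c j) (A j)) \<subseteq>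
      smooth_domain (\<lambda>j. op_scale (inverse (c j)) (op_scale (c j) (A j)))"
    by (intro smooth_domain_subset_op_scale homogeneous_op_scale assms)
  then show "smooth_domain (\<lambda>j. op_scale (c j) (A j)) \<subseteq> smooth_domain A"
    using assms(2) by (simp add: op_scale_op_scale)
qed (intro smooth_domain_subset_op_scale assms)

text \<open>A single nonzero vector fixes the scalar; this later gives uniqueness of the deformation
  matrix.\<close>

lemma commutator_scalar_on_unique:
  assumes "commutator_scalar_on D A B c" "commutator_scalar_on D A B d" "x \<in> D" "x \<noteq> 0"
  shows "c = d"
  using assms unfolding commutator_scalar_on_def by (metis DomainE scaleC_right_cancel)

text \<open>Substitution of \<open>h * c\<close> for \<open>h\<close> in the difference quotient
  produces the factor \<open>c\<close>.\<close>

lemma generator_rescale: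
  assumes "c \<noteq> 0"
  shows "generator (\<lambda>t. V (t * c)) = op_scale c (generator V)"
proof -
  have "(x, y) \<in> generator (\<lambda>t. V (t * c)) \<longleftrightarrow> (x, y /\<^sub>R c) \<in> generator V" for x y
  proof -
    let ?f = "\<lambda>h. (- \<i>) *\<^sub>C ((V h x - x) /\<^sub>R h)"
    have "(x, y) \<in> generator (\<lambda>t. V (t * c)) \<longleftrightarrow> ((\<lambda>h. c *\<^sub>R ?f (h * c)) \<longlongrightarrow> y) (at 0)"
    proof -
      have "c *\<^sub>R ?f (h * c) = (- \<i>) *\<^sub>C ((V (h * c) x - x) /\<^sub>R h)" for h
      proof -
        \<comment> \<open>True at \<open>h = 0\<close> as well, by \<open>inverse 0 = 0\<close>, so
          the two functions agree everywhere.\<close>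
        have "c * inverse (h * c) = inverse h"
          using assms by (simp add: mult.left_commute)
        then show ?thesis
          by (simp only: scaleC_scaleR scaleR_scaleR)
      qed
      then show ?thesis by (simp only: generator_def mem_Collect_eq prod.case)
    qed
    also have "\<dots> \<longleftrightarrow> ((\<lambda>h. ?f (h * c)) \<longlongrightarrow> y /\<^sub>R c) (at 0)"
      using assms tendsto_scaleR[OF tendsto_const[of c], of "\<lambda>h. ?f (h * c)" "y /\<^sub>R c"]
        tendsto_scaleR[OF tendsto_const[of "inverse c"], of "\<lambda>h. c *\<^sub>R ?f (h * c)" y]
      by auto
    also have "\<dots> \<longleftrightarrow> (?f \<longlongrightarrow> y /\<^sub>R c) (at 0)"
    proof -
      \<comment> \<open>Multiplication by \<open>c\<close> is a homeomorphism of the line fixing 0,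
        so it preserves punctured neighbourhoods of 0.\<close>
      have "filtermap (\<lambda>h. h * c) (at 0) = at 0"
        using filtermap_nhds_eq_imp_filtermap_at_eq[OF filtermap_nhds_times[OF assms, of 0]] assms
        by (simp add: mult.commute[of _ c])
      then show ?thesis
        using filterlim_filtermap[of ?f "nhds (y /\<^sub>R c)" "\<lambda>h. h * c" "at 0"] by simp
    qed
    finally show ?thesis by (simp add: generator_def)
  qed
  then show ?thesis
    using assms by (auto simp: mem_op_scale)
qed

section \<open>Weyl systems\<close>

lemma index4_distinct:
  "(1::4) \<noteq> 2" "(1::4) \<noteq> 3" "(1::4) \<noteq> 4" "(2::4) \<noteq> 3" "(2::4) \<noteq> 4" "(3::4) \<noteq> 4"
  by simp_all

lemma quad_simps [simp]:
  "quad a b c d 1 = a" "quad a b c d 2 = b" "quad a b c d 3 = c" "quad a b c d 4 = d"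
  using index4_distinct by (auto simp: quad_def)

lemma comm_form_skew: "comm_form hbar \<theta> B k j = - comm_form hbar \<theta> B j k"
  using exhaust_4[of j] exhaust_4[of k] by (auto simp: comm_form_def)

lemma comm_form_sum_axis:
  "(\<Sum>i\<in>UNIV. \<Sum>l\<in>UNIV. (r *\<^sub>R axis j 1 :: real^4) $ i * comm_form hbar \<theta> B i l *
      (s *\<^sub>R axis k 1 :: real^4) $ l) = r * s * comm_form hbar \<theta> B j k"
proof -
  have "(\<Sum>l\<in>UNIV. (r *\<^sub>R axis j 1 :: real^4) $ i * comm_form hbar \<theta> B i l *
      (s *\<^sub>R axis k 1 :: real^4) $ l) = (if i = j then r * s * comm_form hbar \<theta> B j k else 0)" for i
    by (auto simp: axis_def if_distrib cong: if_cong)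
  then show ?thesis by simp
qed

lemma weyl_system_axis:
  assumes "weyl_system hbar \<theta> B W"
  shows "W (r *\<^sub>R axis j 1) (W (s *\<^sub>R axis k 1) x) =
    exp (- (\<i> / 2) * of_real (r * s * comm_form hbar \<theta> B j k))
      *\<^sub>C W (r *\<^sub>R axis j 1 + s *\<^sub>R axis k 1) x"
proof -
  have "W u (W v x) =
      exp (- (\<i> / 2) * of_real (\<Sum>i\<in>UNIV. \<Sum>l\<in>UNIV. u$i * comm_form hbar \<theta> B i l * v$l))
        *\<^sub>C W (u + v) x" for u v
    using assms unfolding weyl_system_def by blast
  from this[of "r *\<^sub>R axis j 1" "s *\<^sub>R axis k 1"] show ?thesis
    unfolding comm_form_sum_axis .
qed

text \<open>Both orders are multiples of the same operator \<open>W (u + v)\<close>. By skewness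
  their half phases are opposite, and their quotient is the full phase.\<close>

lemma weyl_system_exchange:
  assumes "weyl_system hbar \<theta> B W"
  shows "W (r *\<^sub>R axis j 1) (W (s *\<^sub>R axis k 1) x) =
    exp (- \<i> * of_real (r * s * comm_form hbar \<theta> B j k))
      *\<^sub>C W (s *\<^sub>R axis k 1) (W (r *\<^sub>R axis j 1) x)"
proof -
  define w where "w = r * s * comm_form hbar \<theta> B j k"
  have "s * r * comm_form hbar \<theta> B k j = - w"
    using comm_form_skew[of hbar \<theta> B k j] by (simp add: w_def)
  then show ?thesis
    unfolding weyl_system_axis[OF assms] w_def[symmetric]
    by (simp add: scaleC_scaleC add.commute flip: exp_add)
qed

text \<open>The skew form vanishes on the diagonal, so the multiplier is trivial along each
  axis.\<close>

lemma weyl_system_unitary_group: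
  assumes "weyl_system hbar \<theta> B W"
  shows "unitary_group (\<lambda>t. W (t *\<^sub>R axis j 1))"
  unfolding unitary_group_def
proof (intro conjI allI)
  fix s t x
  have "comm_form hbar \<theta> B j j = 0"
    using comm_form_skew[of hbar \<theta> B j j] by simp
  then show "W ((s + t) *\<^sub>R axis j 1) x = W (s *\<^sub>R axis j 1) (W (t *\<^sub>R axis j 1) x)"
    using weyl_system_axis[OF assms, of s j t j x] by (simp add: scaleR_add_left)
next
  fix x
  have "continuous_on UNIV (\<lambda>s. W s x)"
    using assms by (simp add: weyl_system_def)
  then show "continuous_on UNIV (\<lambda>t. W (t *\<^sub>R axis j 1) x)"
    by (rule continuous_on_compose2) (auto intro!: continuous_intros)
qed (use assms in \<open>auto simp: weyl_system_def\<close>)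

lemma unitary_group_rescale:
  assumes V: "unitary_group V"
  shows "unitary_group (\<lambda>t. V (t * c))"
  unfolding unitary_group_def
proof (intro conjI allI)
  fix s t x
  show "V ((s + t) * c) x = V (s * c) (V (t * c) x)"
    using V unfolding unitary_group_def distrib_right by blast
next
  fix x
  have "continuous_on UNIV (\<lambda>t. V t x)"
    using V by (simp add: unitary_group_def)
  then show "continuous_on UNIV (\<lambda>t. V (t * c) x)"
    by (rule continuous_on_compose2) (auto intro!: continuous_intros)
qed (use V in \<open>simp add: unitary_group_def\<close>)

section \<open>The deformation matrix\<close>

text \<open>Settles existence and uniqueness for the definite description at once, for arbitrary
  nonzero factors \<open>c j\<close>.\<close>

lemma deformation_matrix_op_scale:
  assumes irrep: "regular_irrep hbar \<theta> B X Y Px Py" and c: "\<And>j. c j \<noteq> 0"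
  shows "deformation_matrix (\<lambda>j. op_scale (c j) (quad X Y Px Py j)) =
    (\<chi> i j. - (c i * c j * comm_form hbar \<theta> B i j) / (2 * pi))"
proof -
  define A where "A = quad X Y Px Py"
  define v where "v = (\<lambda>j. op_scale (c j) (A j))"
  obtain W where sa: "\<And>j. self_adjoint (A j)" and dense: "closure (smooth_domain A) = UNIV"
    and comm: "\<And>j k. commutator_scalar_on (smooth_domain A) (A j) (A k)
                (\<i> * of_real (comm_form hbar \<theta> B j k))"
    and W: "weyl_system hbar \<theta> B W" and irr: "irreducible_system W"
    and gen: "\<And>j. A j = generator (\<lambda>t. W (t *\<^sub>R axis j 1))"
    using irrep unfolding regular_irrep_def Let_def A_def[symmetric] by blast
  have hom: "homogeneous_op (A j)" for j
    by (rule self_adjoint_homogeneous[OF sa])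
  have D: "smooth_domain v = smooth_domain A"
    unfolding v_def by (rule smooth_domain_op_scale[OF hom c])
  \<comment> \<open>Irreducibility supplies a nonzero vector of the space; density then keeps the
    smooth domain from being contained in \<open>{0}\<close>.\<close>
  obtain x where x: "x \<in> smooth_domain v" "x \<noteq> 0"
  proof -
    have "\<not> smooth_domain A \<subseteq> {0}"
    proof
      assume "smooth_domain A \<subseteq> {0}"
      then have "closure (smooth_domain A) \<subseteq> {0}"
        by (rule closure_minimal) simp
      with dense irr show False by (auto simp: irreducible_system_def)
    qed
    then show ?thesis using that D by auto
  qed
  \<comment> \<open>The group generated by \<open>v j\<close> is the axis group of \<open>W\<close>
    run at speed \<open>c j\<close>; its value at time 1 is the exponential.\<close>
  have exp_v: "exp_i (v j) = W (c j *\<^sub>R axis j 1)" for j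
  proof -
    have "v j = generator (\<lambda>t. W ((t * c j) *\<^sub>R axis j 1))"
      using generator_rescale[OF c[of j], of "\<lambda>t. W (t *\<^sub>R axis j 1)"] by (simp add: v_def gen)
    moreover have "unitary_group (\<lambda>t. W ((t * c j) *\<^sub>R axis j 1))"
      by (rule unitary_group_rescale[OF weyl_system_unitary_group[OF W]])
    moreover have "self_adjoint (v j)"
      unfolding v_def by (rule self_adjoint_op_scale[OF sa c])
    ultimately show ?thesis
      using exp_i_generator[of "\<lambda>t. W ((t * c j) *\<^sub>R axis j 1)"] by simp
  qed
  define T :: "real^4^4" where
    "T = (\<chi> i j. - (c i * c j * comm_form hbar \<theta> B i j) / (2 * pi))"
  \<comment> \<open>This one number is the exponent of the exchange phase, and its negative is the
    commutator scalar, so \<open>T\<close> meets both conditions.\<close>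
  have T: "2 * of_real pi * \<i> * of_real (T$i$j) =
      - \<i> * of_real (c i * c j * comm_form hbar \<theta> B i j)" for i j
    by (simp add: T_def)
  have T_comm: "commutator_scalar_on (smooth_domain v) (v i) (v j)
      (- (2 * of_real pi * \<i> * of_real (T$i$j)))" for i j
    using commutator_scalar_on_op_scale[OF hom hom c[of i] c[of j] comm[of i j]]
    unfolding T D unfolding v_def by (simp add: mult_ac)
  have "deformation_matrix v = T"
    unfolding deformation_matrix_def
  proof (rule the_equality, intro conjI allI)
    show "T$j$i = - T$i$j" for i j
      using comm_form_skew[of hbar \<theta> B i j] by (simp add: T_def mult_ac)
    show "exp_i (v i) (exp_i (v j) x) =
        exp (2 * of_real pi * \<i> * of_real (T$i$j)) *\<^sub>C exp_i (v j) (exp_i (v i) x)" for i j x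
      unfolding exp_v T by (rule weyl_system_exchange[OF W])
  next
    fix S :: "real^4^4"
    assume S: "(\<forall>i j. S$j$i = - S$i$j) \<and>
      (\<forall>i j. commutator_scalar_on (smooth_domain v) (v i) (v j)
              (- (2 * of_real pi * \<i> * of_real (S$i$j)))) \<and>
      (\<forall>i j x. exp_i (v i) (exp_i (v j) x) =
        exp (2 * of_real pi * \<i> * of_real (S$i$j)) *\<^sub>C exp_i (v j) (exp_i (v i) x))"
    \<comment> \<open>The commutator condition at the nonzero smooth vector determines each entry
      exactly, not just modulo integers.\<close>
    have "- (2 * of_real pi * \<i> * of_real (S$i$j)) = - (2 * of_real pi * \<i> * of_real (T$i$j))"
      for i j
      using commutator_scalar_on_unique[OF _ T_comm x] S by blast
    then show "S = T"
      by (simp add: vec_eq_iff)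
  qed (rule T_comm)
  then show ?thesis
    by (simp add: v_def A_def T_def)
qed

section \<open>The Pfaffian for the intrinsic normalization\<close>

lemma Pf_deformation_matrix_intrinsic:
  assumes "hbar \<noteq> 0" "regular_irrep hbar \<theta> B X Y Px Py" "ax > 0" "ay > 0"
  shows "Pf (deformation_matrix (intrinsic_v hbar ax ay X Y Px Py)) =
    (\<theta> * B - hbar) / ((2 * pi)\<^sup>2 * hbar)"
proof -
  define c where "c = quad (1 / ax) (1 / ay) (ax / hbar) (ay / hbar)"
  have c: "c j \<noteq> 0" for j
    using exhaust_4[of j] assms by (auto simp: c_def)
  have "intrinsic_v hbar ax ay X Y Px Py = (\<lambda>j. op_scale (c j) (quad X Y Px Py j))"
    by (rule ext) (simp add: intrinsic_v_def c_def quad_def)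
  then have T: "deformation_matrix (intrinsic_v hbar ax ay X Y Px Py) $ i $ j =
      - (c i * c j * comm_form hbar \<theta> B i j) / (2 * pi)" for i j
    using deformation_matrix_op_scale[OF assms(2), of c, OF c] by simp
  \<comment> \<open>The entries 14 and 23 vanish. The remaining two products share the factor
    \<open>c 1 * c 2 * c 3 * c 4\<close> and contribute \<open>\<theta> * (hbar * B)\<close> and
    \<open>hbar * hbar\<close>.\<close>
  have "Pf (deformation_matrix (intrinsic_v hbar ax ay X Y Px Py)) =
      (c 1 * c 2 * c 3 * c 4) * (\<theta> * (hbar * B) - hbar * hbar) / (2 * pi)\<^sup>2"
    unfolding Pf_def T
    by (simp add: comm_form_def power2_eq_square diff_divide_distrib right_diff_distrib mult_ac)
  \<comment> \<open>Each period occurs once in a numerator and once in a denominator, which is why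
    the area drops out.\<close>
  also have "c 1 * c 2 * c 3 * c 4 = 1 / (hbar * hbar)"
    using assms by (simp add: c_def)
  also have "1 / (hbar * hbar) * (\<theta> * (hbar * B) - hbar * hbar) / (2 * pi)\<^sup>2 =
      (\<theta> * B - hbar) / ((2 * pi)\<^sup>2 * hbar)"
    using assms(1) by (simp add: right_diff_distrib diff_divide_distrib)
  finally show ?thesis .
qed

theorem proposition5p1:
  fixes hbar \<theta> B ax ay :: real
    and X Y Px Py :: "'h::complex_hilbert op"
    and \<Theta> :: "real \<Rightarrow> real \<Rightarrow> real^4^4"
  assumes "nondegenerate hbar \<theta> B"
    and "regular_irrep hbar \<theta> B X Y Px Py"
  defines "\<Theta> \<equiv> \<lambda>ax ay. deformation_matrix (intrinsic_v hbar ax ay X Y Px Py)"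
  assumes "ax > 0" and "ay > 0"
  shows "Pf (\<Theta> ax ay) = (\<theta> * B - hbar) / ((2 * pi)\<^sup>2 * hbar) \<and>
    (\<exists>c. \<forall>ax' ay'. ax' > 0 \<longrightarrow> ay' > 0 \<longrightarrow>
       Pf (\<Theta> ax' ay') = c \<and>
       (\<forall>\<kappa>. K0_coordinates (\<Theta> ax' ay') \<kappa> \<longrightarrow>
          (\<forall>P \<in> projections (\<Theta> ax' ay').
             gap_label (\<Theta> ax' ay') P =
               gap_label_form (\<Theta> ax' ay') c (\<kappa> (K0_class (\<Theta> ax' ay') P)))))"
proof -
  have "hbar \<noteq> 0"
    using assms(1) by (simp add: nondegenerate_def)
  \<comment> \<open>Kept general in the periods, since the second conjunct quantifies over all
    positive ones.\<close>
  then have Pf: "Pf (\<Theta> ax' ay') = (\<theta> * B - hbar) / ((2 * pi)\<^sup>2 * hbar)"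
    if "ax' > 0" "ay' > 0" for ax' ay'
    unfolding \<Theta>_def using Pf_deformation_matrix_intrinsic assms(2) that by blast
  \<comment> \<open>The witness for \<open>c\<close> is this closed form; the gap-label formula in
    \<open>K0_coordinates\<close> then holds with \<open>c\<close> in place of the Pfaffian.\<close>
  show ?thesis
    using Pf assms(4,5) by (metis K0_coordinates_def)
qed

end
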